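(* For every integer $l\ge2$ there are positive constants $a(l)$ and $b(l)$, depending only on $l$, such that for every integer $p\ge 2$ with $pl$ even, $$(a(l))^{p}\cdot p^{p(l/2-1)}\le \mu_{l,p}(\text{standard})\le \mu_{l,p}^*(\text{full})\le (b(l))^{p}\cdot p^{p(l/2-1)}.$$
   Context: A set-collection $\mathcal A=\{A_1,\ldots,A_p\}$ is a finite family of finite sets, not necessarily different (i.e. an unordered collection with multiplicities allowed). Two set-collections $\{A_1,\ldots,A_p\}$ and $\{B_1,\ldots,B_p\}$ are equal if there is a bijection $\sigma$ of $\{1,\ldots,p\}$ with $A_{\sigma(k)}=B_k$ for all $k$. They are isomorphic if there is a bijection $\phi:\bigcup_k A_k\to\bigcup_k B_k$ such that $\{\phi(A_1),\ldots,\phi(A_p)\}=\{B_1,\ldots,B_p\}$ as set-collections; isomorphism is an equivalence relation and its classes are called E-classes. A set-collection is a double-covering if each $a\in\bigcup_{k=1}^pA_k$ belongs to exactly two of the sets $A_k$ (counted by index $k$). A set-collection $\mathcal A$ is connected if for any two different elements $A,B\in\mathcal A$ there is a sequence $A=E_0,E_1,\ldots,E_m=B$ with all $E_j\in\mathcal A$ and $E_j\cap E_{j+1}\ne\varnothing$ for $j=0,\ldots,m-1$. Every set-collection of nonempty sets is uniquely the union (with multiplicities) of its connected components $\mathcal A_1,\ldots,\mathcal A_n$, the maximal connected subcollections. A set-collection is standard if the E-classes of its connected components are pairwise different (no two components are isomorphic). For integers $l,p\ge2$: $\mu_{l,p}(\text{standard})$ is the number of E-classes of standard double-coverings $\{A_1,\ldots,A_p\}$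 with $\#(A_k)=l$ for all $k$; $\mu_{l,p}^*(\text{full})$ is the number of E-classes of all double-coverings $\{A_1,\ldots,A_p\}$ with $1\le\#(A_k)\le l$ for all $k$. *)

theory Defs
  imports Complex_Main "HOL-Library.Multiset"
begin

text \<open>A set-collection is a finite unordered family of finite sets, repetitions allowed: a
  multiset of finite sets. Multiset equality is equality of set-collections.\<close>

definition set_collection :: "'a set multiset \<Rightarrow> bool" where
  "set_collection \<A> \<longleftrightarrow> (\<forall>A \<in># \<A>. finite A)"

definition isomorphic :: "'a set multiset \<Rightarrow> 'b set multiset \<Rightarrow> bool" where
  "isomorphic \<A> \<B> \<longleftrightarrow>
     (\<exists>\<phi>. bij_betw \<phi> (\<Union>(set_mset \<A>)) (\<Union>(set_mset \<B>)) \<and> image_mset (image \<phi>) \<A> = \<B>)"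

definition double_covering :: "'a set multiset \<Rightarrow> bool" where
  "double_covering \<A> \<longleftrightarrow>
     (\<forall>a \<in> \<Union>(set_mset \<A>). size (filter_mset (\<lambda>A. a \<in> A) \<A>) = 2)"

definition connected_collection :: "'a set multiset \<Rightarrow> bool" where
  "connected_collection \<A> \<longleftrightarrow>
     (\<forall>A \<in># \<A>. \<forall>B \<in># \<A>. A \<noteq> B \<longrightarrow>
        (\<exists>(m::nat) E. E 0 = A \<and> E m = B \<and> (\<forall>j\<le>m. E j \<in># \<A>) \<and>
           (\<forall>j<m. E j \<inter> E (Suc j) \<noteq> {})))"

definition connected_component_of :: "'a set multiset \<Rightarrow> 'a set multiset \<Rightarrow> bool" where
  "connected_component_of \<A> \<C> \<longleftrightarrow>
     \<C> \<subseteq># \<A> \<and> connected_collection \<C> \<and>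
     (\<forall>\<D>. \<D> \<subseteq># \<A> \<and> connected_collection \<D> \<and> \<C> \<subseteq># \<D> \<longrightarrow> \<D> = \<C>)"

text \<open>Components are only used for collections of nonempty sets. There a component contains all
  copies of each of its members, so different components are different as multisets and
  quantifying over the multisets \<open>\<C> \<noteq> \<D>\<close> loses no multiplicity.\<close>

definition standard :: "'a set multiset \<Rightarrow> bool" where
  "standard \<A> \<longleftrightarrow>
     (\<forall>\<C> \<D>. connected_component_of \<A> \<C> \<and> connected_component_of \<A> \<D> \<and> \<C> \<noteq> \<D> \<longrightarrow>
        \<not> isomorphic \<C> \<D>)"

definition E_rel :: "('a set multiset \<times> 'a set multiset) set" where
  "E_rel = {(\<A>, \<B>). set_collection \<A> \<and> set_collection \<B> \<and> isomorphic \<A> \<B>}"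

lemma isomorphic_refl: "isomorphic \<A> \<A>"
  unfolding isomorphic_def by (rule exI[of _ id]) simp

lemma isomorphic_sym:
  assumes "isomorphic \<A> \<B>"
  shows "isomorphic \<B> \<A>"
proof -
  obtain \<phi> where \<phi>: "bij_betw \<phi> (\<Union>(set_mset \<A>)) (\<Union>(set_mset \<B>))"
    and im: "image_mset (image \<phi>) \<A> = \<B>"
    using assms unfolding isomorphic_def by blast
  define \<psi> where "\<psi> = inv_into (\<Union>(set_mset \<A>)) \<phi>"
  have inj: "inj_on \<phi> (\<Union>(set_mset \<A>))"
    using \<phi> by (simp add: bij_betw_def)
  have "\<psi> ` \<phi> ` A = A" if "A \<in># \<A>" for A
    unfolding \<psi>_def by (rule inv_into_image_cancel[OF inj]) (use that in blast)
  then have "image_mset (image \<psi>) \<B> = \<A>"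
    unfolding im[symmetric] by (simp add: multiset.map_comp o_def cong: image_mset_cong)
  with bij_betw_inv_into[OF \<phi>] show ?thesis
    unfolding isomorphic_def \<psi>_def by blast
qed

lemma isomorphic_trans:
  assumes "isomorphic \<A> \<B>" and "isomorphic \<B> \<C>"
  shows "isomorphic \<A> \<C>"
proof -
  obtain \<phi> \<psi> where
    \<phi>: "bij_betw \<phi> (\<Union>(set_mset \<A>)) (\<Union>(set_mset \<B>))" "image_mset (image \<phi>) \<A> = \<B>" and
    \<psi>: "bij_betw \<psi> (\<Union>(set_mset \<B>)) (\<Union>(set_mset \<C>))" "image_mset (image \<psi>) \<B> = \<C>"
    using assms unfolding isomorphic_def by blast
  have "image_mset (image (\<psi> \<circ> \<phi>)) \<A> = \<C>"
    using \<phi>(2) \<psi>(2) by (auto simp: multiset.map_comp o_def image_image)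
  with bij_betw_trans[OF \<phi>(1) \<psi>(1)] show ?thesis
    unfolding isomorphic_def by blast
qed

lemma equiv_E_rel: "equiv {\<A>. set_collection \<A>} E_rel"
proof (rule equivI)
  show "E_rel \<subseteq> {\<A>. set_collection \<A>} \<times> {\<A>. set_collection \<A>}"
    by (auto simp: E_rel_def)
  show "refl_on {\<A>. set_collection \<A>} E_rel"
    by (auto simp: refl_on_def E_rel_def isomorphic_refl)
  show "sym E_rel"
    by (auto simp: sym_def E_rel_def isomorphic_sym)
  show "trans E_rel"
    unfolding trans_def E_rel_def using isomorphic_trans by blast
qed

text \<open>E-classes can be counted among collections of sets of natural numbers:\<close>

lemma isomorphic_to_nat_collection:
  assumes "set_collection \<A>"
  shows "\<exists>\<B> :: nat set multiset. set_collection \<B> \<and> isomorphic \<A> \<B>"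
proof -
  have "finite (\<Union>(set_mset \<A>))"
    using assms by (auto simp: set_collection_def)
  then obtain \<phi> :: "'a \<Rightarrow> nat" where \<phi>: "inj_on \<phi> (\<Union>(set_mset \<A>))"
    using finite_imp_inj_to_nat_seg by blast
  let ?\<B> = "image_mset (image \<phi>) \<A>"
  have "\<Union>(set_mset ?\<B>) = \<phi> ` \<Union>(set_mset \<A>)"
    by auto
  with \<phi> have "isomorphic \<A> ?\<B>"
    unfolding isomorphic_def bij_betw_def by metis
  moreover have "set_collection ?\<B>"
    using assms by (auto simp: set_collection_def)
  ultimately show ?thesis by blast
qed

text \<open>The properties below are invariant under isomorphism, so the quotients are sets of full
  E-classes. They are finite, so \<open>card\<close> is not the junk value of an infinite set.\<close>

definition mu_standard :: "nat \<Rightarrow> nat \<Rightarrow> nat" where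
  "mu_standard l p =
     card ({\<A> :: nat set multiset. set_collection \<A> \<and> size \<A> = p \<and> double_covering \<A> \<and>
              standard \<A> \<and> (\<forall>A \<in># \<A>. card A = l)} // E_rel)"

definition mu_full :: "nat \<Rightarrow> nat \<Rightarrow> nat" where
  "mu_full l p =
     card ({\<A> :: nat set multiset. set_collection \<A> \<and> size \<A> = p \<and> double_covering \<A> \<and>
              (\<forall>A \<in># \<A>. 1 \<le> card A \<and> card A \<le> l)} // E_rel)"

end

(* Read a double covering as a loopless multigraph: the sets are the vertices, the elements are the
   edges.

   Upper bound. In a breadth-first order of the vertices the parent function of a spanning forest is
   monotone, so it costs only C^p. One non-tree edge per component also costs C^p in total: these
   edges occur in the order of the components, so their ends form monotone sequences. At most
   p(l/2 - 1) edges remain; listed by increasing first end, they are expensive only in their second ends,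
   with at most p choices each.

   Lower bound. Take a Hamiltonian cycle and add p(l/2 - 1) chords given by a permutation; the
   result is connected, hence standard. An isomorphism between two such graphs maps the cycle to a
   walk, for which there are at most p C^p choices, and once it is known every chord has boundedly
   many candidates. So each isomorphism class contains at most C^p of about (p(l/2 - 1))! graphs. *)

theory Submission
  imports Defs "HOL-Combinatorics.Permutations"
begin

subsection \<open>Collections of vertex stars\<close>

text \<open>The elements are positions in the edge list rather than pairs of ends, so parallel edges
  remain different elements.\<close>

definition star_sets :: "nat \<Rightarrow> (nat \<times> nat) list \<Rightarrow> nat set list" where
  "star_sets p es =
     map (\<lambda>v. {k. k < length es \<and> (v = fst (es ! k) \<or> v = snd (es ! k))}) [0..<p]"

lemma length_star_sets [simp]: "length (star_sets p es) = p"
  by (simp add: star_sets_def)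

lemma nth_star_sets [simp]:
  "v < p \<Longrightarrow> star_sets p es ! v = {k. k < length es \<and> (v = fst (es ! k) \<or> v = snd (es ! k))}"
  by (simp add: star_sets_def)

lemma finite_star_sets: "A \<in> set (star_sets p es) \<Longrightarrow> finite A"
  by (auto simp: star_sets_def)

text \<open>The isomorphism is \<open>nth xs\<close>, from positions to elements.
  \<open>ends\<close> puts every position into some star, so its domain is all of
  \<open>{..<length xs}\<close>.\<close>

lemma isomorphic_star_sets:
  fixes As :: "'a set list"
  assumes len: "length As = p" "length es = length xs"
    and dist: "distinct xs" and xs: "set xs = \<Union>(set As)"
    and ends: "\<And>k. k < length xs \<Longrightarrow> fst (es ! k) < p \<and> snd (es ! k) < p"
    and inc: "\<And>k v. k < length xs \<Longrightarrow> v < p \<Longrightarrow>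
      xs ! k \<in> As ! v \<longleftrightarrow> v = fst (es ! k) \<or> v = snd (es ! k)"
  shows "isomorphic (mset (star_sets p es)) (mset As)"
proof -
  have star: "star_sets p es ! v = {k. k < length xs \<and> xs ! k \<in> As ! v}" if "v < p" for v
    using that inc len by auto
  have "\<Union>(set (star_sets p es)) = {..<length xs}"
  proof (intro equalityI subsetI)
    fix k assume "k \<in> \<Union>(set (star_sets p es))"
    then show "k \<in> {..<length xs}"
      using len by (auto simp: star_sets_def)
  next
    fix k assume "k \<in> {..<length xs}"
    with ends[of k] len have "k \<in> star_sets p es ! fst (es ! k)" "fst (es ! k) < length (star_sets p es)"
      by auto
    then show "k \<in> \<Union>(set (star_sets p es))"
      using nth_mem by blast
  qed
  moreover have "bij_betw (nth xs) {..<length xs} (set xs)"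
    using dist by (simp add: bij_betw_nth)
  ultimately have bij: "bij_betw (nth xs) (\<Union>(set (star_sets p es))) (\<Union>(set As))"
    using xs by simp
  have "map (image (nth xs)) (star_sets p es) = As"
  proof (rule nth_equalityI)
    fix v assume "v < length (map (image (nth xs)) (star_sets p es))"
    then have v: "v < p" by simp
    have "nth xs ` {k. k < length xs \<and> xs ! k \<in> As ! v} = As ! v"
    proof -
      have "As ! v \<subseteq> set xs" using v len xs nth_mem by blast
      then show ?thesis by (fastforce simp: in_set_conv_nth image_iff subset_iff)
    qed
    then show "map (image (nth xs)) (star_sets p es) ! v = As ! v"
      using v star by simp
  qed (use len in simp)
  then have "image_mset (image (nth xs)) (mset (star_sets p es)) = mset As"
    by (metis mset_map)
  with bij show ?thesis
    unfolding isomorphic_def by auto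
qed

subsection \<open>Sorted lists\<close>

text \<open>Adding \<open>i\<close> to the entry at position \<open>i\<close> makes a sorted list
  strictly increasing; it is then determined by its set, a subset of
  \<open>{..<n + m}\<close>.\<close>

lemma card_sorted_lists_le:
  "finite {xs :: nat list. sorted xs \<and> set xs \<subseteq> {..<m} \<and> length xs \<le> n}"
  "card {xs :: nat list. sorted xs \<and> set xs \<subseteq> {..<m} \<and> length xs \<le> n} \<le> 2 ^ (n + m)"
proof -
  let ?L = "{xs :: nat list. sorted xs \<and> set xs \<subseteq> {..<m} \<and> length xs \<le> n}"
  define h :: "nat list \<Rightarrow> nat list" where "h = (\<lambda>xs. map (\<lambda>i. xs ! i + i) [0..<length xs])"
  have sd: "sorted_wrt (<) (h xs)" if "sorted xs" for xs
    using that unfolding h_def sorted_wrt_iff_nth_less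
    by (auto intro: add_le_less_mono)
  have inj: "inj_on (set \<circ> h) ?L"
  proof (rule inj_onI)
    fix xs ys assume *: "xs \<in> ?L" "ys \<in> ?L" "(set \<circ> h) xs = (set \<circ> h) ys"
    then have "h xs = h ys"
      using sd strict_sorted_equal by (metis (mono_tags, lifting) comp_apply mem_Collect_eq)
    then have "length xs = length ys" "\<And>i. i < length xs \<Longrightarrow> h xs ! i = h ys ! i"
      unfolding h_def by (auto dest: map_eq_imp_length_eq)
    then show "xs = ys"
      by (intro nth_equalityI) (auto simp: h_def)
  qed
  have sub: "(set \<circ> h) ` ?L \<subseteq> Pow {..<n + m}"
    unfolding h_def by (fastforce simp: subset_iff dest: nth_mem)
  show "finite ?L"
    using inj sub by (meson finite_Pow_iff finite_lessThan inj_on_finite)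
  have "card ?L \<le> card (Pow {..<n + m})"
    by (rule card_inj_on_le[OF inj sub]) simp
  then show "card ?L \<le> 2 ^ (n + m)"
    by (simp add: card_Pow)
qed

subsection \<open>Breadth-first ordering\<close>

text \<open>An index with \<open>g i = i\<close> opens a new component; any other \<open>i\<close> has parent \<open>g i\<close>. Taking the
  earliest possible parent is what makes \<open>g\<close> monotone, hence cheap to encode.\<close>

lemma breadth_first_aux:
  fixes \<A> :: "'a set multiset"
  assumes "n \<le> size \<A>"
  shows "\<exists>Bs M g. mset Bs + M = \<A> \<and> length Bs = n \<and> mono_on {..<n} g \<and>
    (\<forall>i<n. g i \<le> i) \<and> (\<forall>i<n. g i < i \<longrightarrow> Bs ! i \<inter> Bs ! (g i) \<noteq> {}) \<and>
    (\<forall>i<n. g i = i \<longrightarrow> (\<forall>j<i. \<forall>k. i \<le> k \<and> k < n \<longrightarrow> Bs ! j \<inter> Bs ! k = {})) \<and>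
    (\<forall>i<n. \<forall>j < g i. \<forall>C \<in># M. Bs ! j \<inter> C = {})"
  using assms
proof (induction n)
  case 0
  show ?case by (rule exI[of _ "[]"], rule exI[of _ \<A>]) simp
next
  case (Suc n)
  then obtain Bs M and g :: "nat \<Rightarrow> nat" where
    ms: "mset Bs + M = \<A>" and len: "length Bs = n" and mono: "mono_on {..<n} g"
    and le: "\<And>i. i < n \<Longrightarrow> g i \<le> i"
    and par: "\<And>i. i < n \<Longrightarrow> g i < i \<Longrightarrow> Bs ! i \<inter> Bs ! (g i) \<noteq> {}"
    and root: "\<And>i j k. i < n \<Longrightarrow> g i = i \<Longrightarrow> j < i \<Longrightarrow> i \<le> k \<Longrightarrow> k < n \<Longrightarrow> Bs ! j \<inter> Bs ! k = {}"
    and sat: "\<And>i j C. i < n \<Longrightarrow> j < g i \<Longrightarrow> C \<in># M \<Longrightarrow> Bs ! j \<inter> C = {}"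
    by (smt (verit, best) Suc_leD)
  have "M \<noteq> {#}" using ms len Suc.prems by auto
  \<comment> \<open>\<open>x\<close> is the earliest placed index whose set meets a remaining set,
    or \<open>n\<close> if there is none, and then \<open>C\<close> opens a new component. In the
    first case monotonicity comes from the invariant \<open>sat\<close>: nothing remaining meets a
    set placed before a parent already used, so such a parent cannot exceed
    \<open>x\<close>.\<close>
  have "\<exists>C x. C \<in># M \<and> x \<le> n \<and> (\<forall>i<n. g i \<le> x) \<and> (\<forall>j<x. \<forall>C'\<in>#M. Bs ! j \<inter> C' = {}) \<and>
         (x < n \<longrightarrow> C \<inter> Bs ! x \<noteq> {})"
  proof (cases "\<exists>j<n. \<exists>C\<in>#M. Bs ! j \<inter> C \<noteq> {}")
    case True
    define x where "x = (LEAST j. j < n \<and> (\<exists>C\<in>#M. Bs ! j \<inter> C \<noteq> {}))"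
    have x: "x < n \<and> (\<exists>C\<in>#M. Bs ! x \<inter> C \<noteq> {})"
      unfolding x_def by (rule LeastI_ex) (use True in blast)
    then obtain C where C: "C \<in># M" "Bs ! x \<inter> C \<noteq> {}" by blast
    have low: "\<forall>j<x. \<forall>C'\<in>#M. Bs ! j \<inter> C' = {}"
      using x not_less_Least unfolding x_def
      by (metis (mono_tags, lifting) order.strict_trans)
    have "g i \<le> x" if "i < n" for i
      using sat[OF that _ C(1), of x] C(2) by (meson not_le)
    with x C low show ?thesis
      by (intro exI[of _ C] exI[of _ x]) auto
  next
    case False
    obtain C where "C \<in># M" using \<open>M \<noteq> {#}\<close> by blast
    moreover have "\<forall>i<n. g i \<le> n"
      using le by (meson less_imp_le order_trans)
    moreover have "\<forall>j<n. \<forall>C'\<in>#M. Bs ! j \<inter> C' = {}"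
      using False by blast
    ultimately show ?thesis
      by (intro exI[of _ C] exI[of _ n]) simp
  qed
  then obtain C x where C: "C \<in># M" and x: "x \<le> n" and gx: "\<And>i. i < n \<Longrightarrow> g i \<le> x"
    and low: "\<And>j C'. j < x \<Longrightarrow> C' \<in># M \<Longrightarrow> Bs ! j \<inter> C' = {}"
    and nb: "x < n \<Longrightarrow> C \<inter> Bs ! x \<noteq> {}" by blast
  define g' where "g' = g(n := x)"
  have "mset (Bs @ [C]) + (M - {#C#}) = \<A>"
    using C ms by auto
  moreover have "mono_on {..<Suc n} g'"
    using mono gx by (auto simp: mono_on_def g'_def less_Suc_eq)
  moreover have "\<forall>i<Suc n. g' i \<le> i"
    using le x by (simp add: g'_def less_Suc_eq)
  moreover have "(Bs @ [C]) ! i \<inter> (Bs @ [C]) ! (g' i) \<noteq> {}" if i: "i < Suc n" "g' i < i" for i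
  proof (cases "i = n")
    case True
    then show ?thesis using nb i len by (simp add: g'_def nth_append)
  next
    case False
    then have "i < n" "g' i = g i" "g i < n" using i by (auto simp: g'_def)
    then show ?thesis using par[of i] i len by (simp add: nth_append)
  qed
  moreover have "(Bs @ [C]) ! j \<inter> (Bs @ [C]) ! k = {}"
    if i: "i < Suc n" "g' i = i" "j < i" "i \<le> k" "k < Suc n" for i j k
  proof (cases "i = n")
    case True
    then have "k = n" "x = n" using i by (auto simp: g'_def)
    then show ?thesis using low[of j C] C i True len by (simp add: nth_append)
  next
    case False
    then have in': "i < n" "g i = i" using i by (auto simp: g'_def)
    show ?thesis
    proof (cases "k = n")
      case True
      \<comment> \<open>For an old root \<open>i\<close> every \<open>j < i\<close> lies below
        \<open>g i = i\<close>, so \<open>sat\<close> already excludes an intersection with the new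
        set.\<close>
      then show ?thesis using sat[of i j C] C in' i len by (simp add: nth_append)
    next
      case False
      then show ?thesis using root[of i j k] in' i len by (simp add: nth_append)
    qed
  qed
  moreover have "(Bs @ [C]) ! j \<inter> C' = {}" if "i < Suc n" "j < g' i" "C' \<in># M - {#C#}" for i j C'
  proof -
    have "C' \<in># M" using that by (meson in_diffD)
    moreover have "j < x" using that gx[of i] by (cases "i = n") (auto simp: g'_def)
    ultimately show ?thesis using low[of j C'] x len by (simp add: nth_append)
  qed
  ultimately show ?case
    by (intro exI[of _ "Bs @ [C]"] exI[of _ "M - {#C#}"] exI[of _ g']) (use len in simp)
qed

lemma breadth_first_order:
  fixes \<A> :: "'a set multiset"
  obtains Bs g where "mset Bs = \<A>" "mono_on {..<size \<A>} g"
    "\<And>i. i < size \<A> \<Longrightarrow> g i \<le> i"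
    "\<And>i. i < size \<A> \<Longrightarrow> g i < i \<Longrightarrow> Bs ! i \<inter> Bs ! (g i) \<noteq> {}"
    "\<And>i j k. i < size \<A> \<Longrightarrow> g i = i \<Longrightarrow> j < i \<Longrightarrow> i \<le> k \<Longrightarrow> k < size \<A> \<Longrightarrow> Bs ! j \<inter> Bs ! k = {}"
proof -
  obtain Bs M and g :: "nat \<Rightarrow> nat" where *: "mset Bs + M = \<A>" "length Bs = size \<A>"
    "mono_on {..<size \<A>} g" "\<forall>i<size \<A>. g i \<le> i"
    "\<forall>i<size \<A>. g i < i \<longrightarrow> Bs ! i \<inter> Bs ! (g i) \<noteq> {}"
    "\<forall>i<size \<A>. g i = i \<longrightarrow> (\<forall>j<i. \<forall>k. i \<le> k \<and> k < size \<A> \<longrightarrow> Bs ! j \<inter> Bs ! k = {})"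
    using breadth_first_aux[OF order_refl, of \<A>] by (elim exE conjE) blast
  have "size M = 0" using *(1,2) by (metis add_cancel_right_right size_mset size_union)
  then have "mset Bs = \<A>" using *(1) by simp
  moreover have "Bs ! j \<inter> Bs ! k = {}"
    if "i < size \<A>" "g i = i" "j < i" "i \<le> k" "k < size \<A>" for i j k
    using *(6) that by blast
  ultimately show ?thesis using *(3-5) by (intro that[of Bs g]) simp_all
qed

subsection \<open>Encoding double coverings\<close>

text \<open>The decoder: parent edges of the forest, then the edges set aside in the non-tree
  components, then all others. \<open>zip\<close> stops at the shorter list, so \<open>ws\<close>
  may carry padding.\<close>

definition code_edges :: "nat \<Rightarrow> nat list \<Rightarrow> nat list \<Rightarrow> nat list \<Rightarrow> nat list \<Rightarrow> nat list \<Rightarrow> (nat \<times> nat) list" where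
  "code_edges p g hs ks ts ws =
     map (\<lambda>i. (g ! i, i)) (filter (\<lambda>i. g ! i \<noteq> i) [0..<p]) @ zip hs ks @ zip ts ws"

text \<open>The ends are the minimum and maximum of the set of indices containing \<open>a\<close>.
  This set has two members because the covering condition counts with multiplicity, so equal sets at
  different positions cause no loop.\<close>

lemma double_covering_ends:
  fixes Bs :: "'a set list"
  assumes "double_covering (mset Bs)"
  obtains lo hi where "\<And>a. a \<in> \<Union>(set Bs) \<Longrightarrow> lo a < hi a" "\<And>a. a \<in> \<Union>(set Bs) \<Longrightarrow> hi a < length Bs"
    "\<And>a i. a \<in> \<Union>(set Bs) \<Longrightarrow> i < length Bs \<Longrightarrow> a \<in> Bs ! i \<longleftrightarrow> i = lo a \<or> i = hi a"
proof -
  let ?I = "\<lambda>a. {i. i < length Bs \<and> a \<in> Bs ! i}"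
  have I: "?I a = {Min (?I a), Max (?I a)} \<and> Min (?I a) < Max (?I a)" if "a \<in> \<Union>(set Bs)" for a
  proof -
    have "size (filter_mset (\<lambda>A. a \<in> A) (mset Bs)) = 2"
      using assms that unfolding double_covering_def set_mset_mset by blast
    then have "card (?I a) = 2"
      by (metis length_filter_conv_card mset_filter size_mset)
    then obtain x y where xy: "?I a = {x, y}" "x \<noteq> y"
      by (auto simp: card_2_iff)
    show ?thesis
      unfolding xy(1) using xy(2) by (cases "x < y") (simp_all add: insert_commute)
  qed
  show ?thesis
  proof (rule that[of "\<lambda>a. Min (?I a)" "\<lambda>a. Max (?I a)"])
    fix a assume a: "a \<in> \<Union>(set Bs)"
    show "Min (?I a) < Max (?I a)" using I[OF a] by (rule conjunct2)
    have mem: "i \<in> ?I a \<longleftrightarrow> i \<in> {Min (?I a), Max (?I a)}" for i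
      using I[OF a] by (intro arg_cong[where f = "\<lambda>S. i \<in> S"]) (rule conjunct1)
    then have "Max (?I a) \<in> ?I a" by (rule iffD2) simp
    then show "Max (?I a) < length Bs" by (rule CollectE) (rule conjunct1)
    fix i assume "i < length Bs"
    then have "a \<in> Bs ! i \<longleftrightarrow> i \<in> ?I a" by simp
    also have "\<dots> \<longleftrightarrow> i = Min (?I a) \<or> i = Max (?I a)"
      by (rule trans[OF mem]) simp
    finally show "a \<in> Bs ! i \<longleftrightarrow> i = Min (?I a) \<or> i = Max (?I a)" .
  qed
qed

text \<open>In each component that is not a tree, one non-tree edge \<open>c d\<close> costs nothing to encode, because
  the ends of these edges increase with the component. The remaining non-tree edges form \<open>X\<close>, and
  exactly as many edges as vertices of the non-tree components have been set aside.\<close>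

lemma double_covering_code:
  fixes \<A> :: "'a set multiset"
  assumes dc: "double_covering \<A>" and fin: "set_collection \<A>" and size: "size \<A> = p"
    and "p > 0" "l \<ge> 2" and card_le: "\<forall>A \<in># \<A>. card A \<le> l"
  obtains g hs ks ts ws where
    "sorted g" "set g \<subseteq> {..<p}" "length g \<le> p"
    "sorted hs" "set hs \<subseteq> {..<p}" "length hs \<le> p"
    "sorted ks" "set ks \<subseteq> {..<p}" "length ks \<le> p"
    "sorted ts" "set ts \<subseteq> {..<p}" "length ts \<le> p * (l - 2) div 2"
    "set ws \<subseteq> {..<p}" "length ws = p * (l - 2) div 2"
    "isomorphic (mset (star_sets p (code_edges p g hs ks ts ws))) \<A>"
proof -
  define N where "N = p * (l - 2) div 2"
  obtain Bs g where Bs: "mset Bs = \<A>" and mono: "mono_on {..<p} g"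
    and gle: "\<And>i. i < p \<Longrightarrow> g i \<le> i"
    and par: "\<And>i. i < p \<Longrightarrow> g i < i \<Longrightarrow> Bs ! i \<inter> Bs ! (g i) \<noteq> {}"
    and root: "\<And>i j k. i < p \<Longrightarrow> g i = i \<Longrightarrow> j < i \<Longrightarrow> i \<le> k \<Longrightarrow> k < p \<Longrightarrow> Bs ! j \<inter> Bs ! k = {}"
    using breadth_first_order[of \<A>] unfolding size by blast
  have len: "length Bs = p" using Bs size by (metis size_mset)
  define U where "U = \<Union>(set Bs)"
  have finB: "finite (Bs ! i)" and cardB: "card (Bs ! i) \<le> l" if "i < p" for i
    using that fin card_le nth_mem[of i Bs] len unfolding set_collection_def Bs[symmetric] by auto
  have finU: "finite U"
    unfolding U_def using fin Bs by (auto simp: set_collection_def)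
  have inU: "a \<in> U" if "i < p" "a \<in> Bs ! i" for a i
    using that len unfolding U_def by (metis UnionI nth_mem)
  obtain lo hi where lohi: "\<And>a. a \<in> U \<Longrightarrow> lo a < hi a" and hi: "\<And>a. a \<in> U \<Longrightarrow> hi a < p"
    and inc: "\<And>a i. a \<in> U \<Longrightarrow> i < p \<Longrightarrow> a \<in> Bs ! i \<longleftrightarrow> i = lo a \<or> i = hi a"
    using double_covering_ends[OF dc[folded Bs], unfolded len, folded U_def] by blast
  have lo: "lo a < p" if "a \<in> U" for a
    using lohi hi that by (meson order.strict_trans)
  have g0: "g 0 = 0" using gle[of 0] \<open>p > 0\<close> by simp
  \<comment> \<open>The root of the component of \<open>i\<close>. A root separates all earlier sets
    from all later ones, so components are intervals of the order, each beginning at its root. The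
    maximum exists because \<open>g 0 = 0\<close>.\<close>
  define \<rho> where "\<rho> = (\<lambda>i. Max {r. r \<le> i \<and> g r = r})"
  have \<rho>_in: "\<rho> i \<in> {r. r \<le> i \<and> g r = r}" for i
    unfolding \<rho>_def by (rule Max_in) (use g0 in auto)
  have \<rho>_le: "\<rho> i \<le> i" and \<rho>_root: "g (\<rho> i) = \<rho> i" for i
    using \<rho>_in by auto
  have \<rho>_ge: "r \<le> \<rho> i" if "r \<le> i" "g r = r" for r i
    unfolding \<rho>_def by (rule Max_ge) (use that in auto)
  have \<rho>_less: "i < d" if "\<rho> i < d" "g d = d" for i d
    using \<rho>_ge[of d i] that by (meson not_le)
  have \<rho>_ends: "\<rho> (hi a) = \<rho> (lo a)" if "a \<in> U" for a
  proof (rule ccontr)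
    assume ne: "\<rho> (hi a) \<noteq> \<rho> (lo a)"
    have "\<rho> (lo a) \<le> \<rho> (hi a)"
      using \<rho>_ge \<rho>_le \<rho>_root lohi[OF that] by (meson less_imp_le order_trans)
    with ne have "lo a < \<rho> (hi a)" using \<rho>_less \<rho>_root by simp
    then have "Bs ! lo a \<inter> Bs ! hi a = {}"
      using root[of "\<rho> (hi a)" "lo a" "hi a"] \<rho>_le[of "hi a"] \<rho>_root hi[OF that] by simp
    moreover have "a \<in> Bs ! lo a" "a \<in> Bs ! hi a"
      using inc lo hi that by auto
    ultimately show False by blast
  qed
  \<comment> \<open>Each non-root \<open>i\<close> gets a tree element \<open>t i\<close> joining it
    to its parent. Its larger end is \<open>i\<close> itself, so \<open>t\<close> is
    injective.\<close>
  define NR where "NR = {i. i < p \<and> g i \<noteq> i}"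
  have "\<forall>i\<in>NR. \<exists>a. a \<in> Bs ! i \<inter> Bs ! g i"
    using par gle unfolding NR_def by (metis (mono_tags, lifting) ex_in_conv le_neq_implies_less mem_Collect_eq)
  then obtain t where t: "\<And>i. i \<in> NR \<Longrightarrow> t i \<in> Bs ! i \<inter> Bs ! g i"
    by metis
  have tU: "t i \<in> U" and t_lo: "lo (t i) = g i" and t_hi: "hi (t i) = i" if "i \<in> NR" for i
  proof -
    have i: "i < p" "g i < i" "g i < p" using that gle[of i] by (auto simp: NR_def)
    show U: "t i \<in> U" using t[OF that] inU i by blast
    have "i = lo (t i) \<or> i = hi (t i)" "g i = lo (t i) \<or> g i = hi (t i)"
      using inc[OF U] i t[OF that] by auto
    then show "lo (t i) = g i" "hi (t i) = i" using lohi[OF U] i by auto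
  qed
  have inj_t: "inj_on t NR" using t_hi by (rule inj_on_inverseI)
  \<comment> \<open>\<open>S\<close> holds the non-tree elements, \<open>D\<close> the roots of the
    components that contain one. Below, \<open>c d\<close> is the element set aside in the component
    of \<open>d\<close>, and \<open>X\<close> is what remains.\<close>
  define S where "S = U - t ` NR"
  define D where "D = (\<lambda>a. \<rho> (lo a)) ` S"
  have finS: "finite S" and finD: "finite D" using finU by (auto simp: S_def D_def)
  have Dp: "d < p" "g d = d" if dD: "d \<in> D" for d
  proof -
    from dD obtain a where "a \<in> U" "d = \<rho> (lo a)" by (auto simp: D_def S_def)
    then show "d < p" "g d = d" using lo[of a] \<rho>_le[of "lo a"] \<rho>_root by simp_all
  qed
  have "\<forall>d\<in>D. \<exists>a\<in>S. \<rho> (lo a) = d" by (auto simp: D_def)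
  then obtain c where c: "\<And>d. d \<in> D \<Longrightarrow> c d \<in> S" "\<And>d. d \<in> D \<Longrightarrow> \<rho> (lo (c d)) = d"
    by metis
  have cU: "c d \<in> U" if "d \<in> D" for d using c(1)[OF that] by (simp add: S_def)
  have inj_c: "inj_on c D" using c(2) by (rule inj_on_inverseI[where g = "\<lambda>a. \<rho> (lo a)"])
  define X where "X = S - c ` D"
  have finX: "finite X" using finS by (simp add: X_def)
  have XU: "X \<subseteq> U" by (auto simp: X_def S_def)
  have card_X: "card X \<le> N"
  proof -
    \<comment> \<open>\<open>W\<close> and \<open>Y\<close> are the vertices and elements of the
      non-tree components. The forest has \<open>card W - card D\<close> elements there, so
      \<open>card Y = card X + card W\<close>. Counting incidences gives
      \<open>2 * card Y \<le> card W * l\<close>, hence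
      \<open>2 * card X \<le> card W * (l - 2)\<close>.\<close>
    define W where "W = {i. i < p \<and> \<rho> i \<in> D}"
    define Y where "Y = S \<union> t ` (W \<inter> NR)"
    have finW: "finite W" by (simp add: W_def)
    have "W = (W \<inter> NR) \<union> D"
    proof -
      have "\<rho> i = i" if "g i = i" for i
        using \<rho>_ge[of i i] \<rho>_le[of i] that by simp
      then show ?thesis using Dp by (auto simp: W_def NR_def)
    qed
    moreover have "(W \<inter> NR) \<inter> D = {}" using Dp by (auto simp: NR_def)
    ultimately have card_W: "card W = card (W \<inter> NR) + card D"
      using finW finD by (metis card_Un_disjoint finite_Int)
    have "card (t ` (W \<inter> NR)) = card (W \<inter> NR)"
      by (rule card_image) (use inj_t in \<open>auto intro: inj_on_subset\<close>)
    moreover have "S \<inter> t ` (W \<inter> NR) = {}" by (auto simp: S_def)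
    ultimately have card_Y: "card Y = card S + card (W \<inter> NR)"
      unfolding Y_def using finS finW by (simp add: card_Un_disjoint)
    have finY: "finite Y" using finS finW by (simp add: Y_def)
    have Y: "y \<in> U \<and> lo y \<in> W \<and> hi y \<in> W" if yY: "y \<in> Y" for y
    proof -
      have yU: "y \<in> U" using that tU by (auto simp: Y_def S_def)
      have "\<rho> (lo y) \<in> D"
      proof (cases "y \<in> S")
        case False
        with yY obtain i where i: "i \<in> W" "i \<in> NR" "y = t i" unfolding Y_def by blast
        then show ?thesis using \<rho>_ends[OF yU] t_hi[of i] by (simp add: W_def)
      qed (simp add: D_def)
      then show ?thesis using yU \<rho>_ends[OF yU] lo hi by (simp add: W_def)
    qed
    have "(\<Sum>i\<in>W. card {y \<in> Y. y \<in> Bs ! i}) = 2 * card Y"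
    proof (rule sum_multicount[OF finW finY], rule ballI)
      fix y assume "y \<in> Y"
      then have "{i \<in> W. y \<in> Bs ! i} = {lo y, hi y}"
        using Y[of y] inc by (auto simp: W_def)
      then show "card {i \<in> W. y \<in> Bs ! i} = 2"
        using lohi Y[OF \<open>y \<in> Y\<close>] by (simp add: card_2_iff) (metis nat_neq_iff)
    qed
    moreover have "(\<Sum>i\<in>W. card {y \<in> Y. y \<in> Bs ! i}) \<le> card W * l"
    proof (rule sum_bounded_above[where 'a = nat, simplified])
      fix i assume "i \<in> W"
      then have "i < p" by (simp add: W_def)
      then have "card {y \<in> Y. y \<in> Bs ! i} \<le> card (Bs ! i)"
        using finB by (intro card_mono) auto
      then show "card {y \<in> Y. y \<in> Bs ! i} \<le> l" using cardB \<open>i < p\<close> by (meson order_trans)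
    qed
    ultimately have "2 * card Y \<le> card W * l" by simp
    moreover have "card X = card S - card D"
      unfolding X_def using c(1) finD card_image[OF inj_c]
      by (subst card_Diff_subset) auto
    moreover have "card D \<le> card S"
      by (rule card_inj_on_le[OF inj_c _ finS]) (use c(1) in blast)
    moreover have "card W * l = card W * (l - 2) + 2 * card W"
      using \<open>l \<ge> 2\<close> by (metis add.commute distrib_left le_add_diff_inverse mult.commute)
    moreover have "card W * (l - 2) \<le> p * (l - 2)"
      by (intro mult_le_mono1) (use card_mono[of "{..<p}" W] in \<open>auto simp: W_def\<close>)
    ultimately have "2 * card X \<le> p * (l - 2)"
      using card_W card_Y by linarith
    then show ?thesis unfolding N_def by linarith
  qed
  define ns where "ns = filter (\<lambda>i. g i \<noteq> i) [0..<p]"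
  have set_ns: "set ns = NR" by (auto simp: ns_def NR_def)
  define ds where "ds = sorted_list_of_set D"
  have ds: "set ds = D" "sorted_wrt (<) ds" "distinct ds" "length ds = card D"
    unfolding ds_def using finD by simp_all
  obtain xl0 where xl0: "set xl0 = X" "distinct xl0"
    using finite_distinct_list[OF finX] by blast
  define xl where "xl = sort_key lo xl0"
  have xl: "set xl = X" "distinct xl" "sorted (map lo xl)" "length xl = card X"
    using xl0 by (auto simp: xl_def distinct_card)
  define xs where "xs = map t ns @ map c ds @ xl"
  \<comment> \<open>Padding gives all second-end lists the same length \<open>N\<close>, so that
    they number \<open>p ^ N\<close>; decoding ignores it. The value 0 is a legal entry because
    \<open>p > 0\<close>.\<close>
  define ws where "ws = map hi xl @ replicate (N - length xl) 0"
  have lws: "length ws = N" using card_X xl by (simp add: ws_def)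
  have e1: "map (\<lambda>i. (map g [0..<p] ! i, i)) (filter (\<lambda>i. map g [0..<p] ! i \<noteq> i) [0..<p]) =
      map (\<lambda>a. (lo a, hi a)) (map t ns)"
  proof -
    have "filter (\<lambda>i. map g [0..<p] ! i \<noteq> i) [0..<p] = ns"
      unfolding ns_def by (rule filter_cong) auto
    moreover have "map g [0..<p] ! i = g i" if "i \<in> set ns" for i
      using that by (simp add: set_ns NR_def)
    ultimately show ?thesis using t_lo t_hi set_ns by simp
  qed
  have e2: "zip (map (lo \<circ> c) ds) (map (hi \<circ> c) ds) = map (\<lambda>a. (lo a, hi a)) (map c ds)"
    by (simp add: zip_map_map zip_same_conv_map)
  have e3: "zip (map lo xl) ws = map (\<lambda>a. (lo a, hi a)) xl"
    by (rule nth_equalityI) (use lws card_X xl in \<open>auto simp: ws_def nth_append\<close>)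
  have es: "code_edges p (map g [0..<p]) (map (lo \<circ> c) ds) (map (hi \<circ> c) ds) (map lo xl) ws =
      map (\<lambda>a. (lo a, hi a)) xs"
    unfolding code_edges_def xs_def map_append e1 e2 e3 ..
  have set_xs: "set xs = U"
  proof -
    have "set xs = t ` NR \<union> c ` D \<union> X"
      using ds xl by (auto simp: xs_def set_ns)
    also have "\<dots> = U"
      unfolding X_def S_def using tU cU by blast
    finally show ?thesis .
  qed
  have "distinct ns" by (simp add: ns_def)
  moreover have "t ` NR \<inter> c ` D = {}"
  proof -
    have "c ` D \<subseteq> - t ` NR"
      by (rule image_subsetI) (use c(1) in \<open>simp add: S_def\<close>)
    then show ?thesis by blast
  qed
  moreover have "t ` NR \<inter> X = {}" "c ` D \<inter> X = {}"
    by (auto simp: S_def X_def)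
  ultimately have "distinct xs"
    using inj_t inj_c ds xl(1,2) by (simp add: xs_def distinct_map set_ns Int_Un_distrib)
  then have iso: "isomorphic (mset (star_sets p (map (\<lambda>a. (lo a, hi a)) xs))) (mset Bs)"
  proof (rule isomorphic_star_sets[rotated 2])
    fix k assume k: "k < length xs"
    then have "xs ! k \<in> U" using set_xs nth_mem by blast
    then show "fst (map (\<lambda>a. (lo a, hi a)) xs ! k) < p \<and> snd (map (\<lambda>a. (lo a, hi a)) xs ! k) < p"
      using k lo hi by simp
  next
    fix k v assume k: "k < length xs" and "v < p"
    then have "xs ! k \<in> U" using set_xs nth_mem by blast
    with \<open>v < p\<close> show "xs ! k \<in> Bs ! v \<longleftrightarrow>
        v = fst (map (\<lambda>a. (lo a, hi a)) xs ! k) \<or> v = snd (map (\<lambda>a. (lo a, hi a)) xs ! k)"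
      using inc \<open>xs ! k \<in> U\<close> k by simp
  qed (use len set_xs in \<open>simp_all add: U_def\<close>)
  \<comment> \<open>Both ends of \<open>c d\<close> lie in the interval of the component of
    \<open>d\<close>, which ends before the next root; hence the argument serves \<open>lo\<close>
    and \<open>hi\<close> alike.\<close>
  have sorted_ends: "sorted (map (e \<circ> c) ds)" if e: "\<And>a. a \<in> U \<Longrightarrow> \<rho> (e a) = \<rho> (lo a)" for e
    unfolding sorted_wrt_map
  proof (rule sorted_wrt_mono_rel[OF _ ds(2)])
    fix d d' assume d: "d \<in> set ds" "d' \<in> set ds" "d < d'"
    then have \<rho>: "\<rho> (e (c d)) = d" "\<rho> (e (c d')) = d'"
      using e cU c(2) ds(1) by simp_all
    have "e (c d) < d'"
      by (rule \<rho>_less) (use \<rho> d Dp ds(1) in simp_all)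
    also have "d' \<le> e (c d')" using \<rho>_le[of "e (c d')"] \<rho> by simp
    finally show "(e \<circ> c) d \<le> (e \<circ> c) d'" by simp
  qed
  have "sorted (map g [0..<p])"
    using mono by (auto simp: sorted_iff_nth_mono mono_on_def)
  moreover have "set (map g [0..<p]) \<subseteq> {..<p}" using gle order.strict_trans1 by fastforce
  moreover have "length ds \<le> p"
    using ds card_mono[of "{..<p}" D] Dp by auto
  moreover have "set (map (lo \<circ> c) ds) \<subseteq> {..<p}" "set (map (hi \<circ> c) ds) \<subseteq> {..<p}"
    "set (map lo xl) \<subseteq> {..<p}" "set ws \<subseteq> {..<p}"
    using lo hi cU ds(1) XU xl(1) \<open>p > 0\<close> by (auto simp: ws_def)
  moreover have "length ws = p * (l - 2) div 2" "length (map lo xl) \<le> p * (l - 2) div 2"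
    using lws card_X xl unfolding N_def by simp_all
  ultimately show ?thesis
    using sorted_ends[of lo] sorted_ends[of hi] \<rho>_ends xl(3) iso es Bs
    by (intro that[of "map g [0..<p]" "map (lo \<circ> c) ds" "map (hi \<circ> c) ds" "map lo xl" ws]) simp_all
qed

subsection \<open>The upper bound\<close>

lemma set_collection_star_sets: "set_collection (mset (star_sets p es))"
  using finite_star_sets by (auto simp: set_collection_def)

text \<open>Every class comes from a code. The three sorted lists of length at most \<open>p\<close>
  contribute \<open>2 ^ (6 * p)\<close>, \<open>ts\<close> contributes \<open>2 ^ (N + p)\<close>
  and \<open>ws\<close> contributes \<open>p ^ N\<close>. Finiteness is recorded for the later
  comparisons of cardinalities.\<close>

lemma mu_full_bound:
  assumes "p > 0" "l \<ge> 2" and N: "N = p * (l - 2) div 2"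
  shows "finite ({\<A> :: nat set multiset. set_collection \<A> \<and> size \<A> = p \<and> double_covering \<A> \<and>
              (\<forall>A \<in># \<A>. 1 \<le> card A \<and> card A \<le> l)} // E_rel)" (is "finite (?F // _)")
    and "mu_full l p \<le> 2 ^ (7 * p + N) * p ^ N"
proof -
  define SL where "SL = (\<lambda>n. {xs :: nat list. sorted xs \<and> set xs \<subseteq> {..<p} \<and> length xs \<le> n})"
  define C where "C = SL p \<times> SL p \<times> SL p \<times> SL N \<times> {ws. set ws \<subseteq> {..<p} \<and> length ws = N}"
  define h where "h = (\<lambda>(g, hs, ks, ts, ws). E_rel `` {mset (star_sets p (code_edges p g hs ks ts ws))})"
  have sub: "?F // E_rel \<subseteq> h ` C"
  proof
    fix q assume "q \<in> ?F // E_rel"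
    then obtain \<A> where \<A>: "\<A> \<in> ?F" and q: "q = E_rel `` {\<A>}"
      by (rule quotientE)
    obtain g hs ks ts ws where code: "(g, hs, ks, ts, ws) \<in> C"
      and iso: "isomorphic (mset (star_sets p (code_edges p g hs ks ts ws))) \<A>"
    proof (rule double_covering_code[of \<A> p l])
      fix g hs ks ts ws
      assume "sorted g" "set g \<subseteq> {..<p}" "length g \<le> p"
        "sorted hs" "set hs \<subseteq> {..<p}" "length hs \<le> p"
        "sorted ks" "set ks \<subseteq> {..<p}" "length ks \<le> p"
        "sorted ts" "set ts \<subseteq> {..<p}" "length ts \<le> p * (l - 2) div 2"
        "set ws \<subseteq> {..<p}" "length ws = p * (l - 2) div 2"
        "isomorphic (mset (star_sets p (code_edges p g hs ks ts ws))) \<A>"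
      then show thesis
        by (intro that[of g hs ks ts ws]) (simp_all add: C_def SL_def N)
    qed (use \<A> assms in auto)
    have "(mset (star_sets p (code_edges p g hs ks ts ws)), \<A>) \<in> E_rel"
      using iso \<A> set_collection_star_sets by (simp add: E_rel_def)
    then have "E_rel `` {mset (star_sets p (code_edges p g hs ks ts ws))} = E_rel `` {\<A>}"
      by (rule equiv_class_eq[OF equiv_E_rel])
    with code q show "q \<in> h ` C"
      by (intro image_eqI[of _ _ "(g, hs, ks, ts, ws)"]) (simp_all add: h_def)
  qed
  have finC: "finite C"
    unfolding C_def SL_def
    by (intro finite_cartesian_product card_sorted_lists_le(1) finite_lists_length_eq) simp
  then show "finite (?F // E_rel)"
    using sub by (rule finite_surj)
  have "mu_full l p \<le> card C"
    unfolding mu_full_def using surj_card_le[OF finC sub] .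
  also have "card C = card (SL p) * (card (SL p) * (card (SL p) * (card (SL N) * p ^ N)))"
    unfolding C_def using card_lists_length_eq[of "{..<p}" N] by (simp add: card_cartesian_product)
  also have "\<dots> \<le> 2 ^ (p + p) * (2 ^ (p + p) * (2 ^ (p + p) * (2 ^ (N + p) * p ^ N)))"
    unfolding SL_def by (intro mult_le_mono card_sorted_lists_le(2) order_refl)
  also have "\<dots> = 2 ^ (7 * p + N) * p ^ N"
    by (simp add: power_add[symmetric] mult.assoc[symmetric])
  finally show "mu_full l p \<le> 2 ^ (7 * p + N) * p ^ N" .
qed

lemma mu_standard_le_mu_full:
  assumes "p > 0" "l \<ge> 2"
  shows "mu_standard l p \<le> mu_full l p"
  unfolding mu_standard_def mu_full_def
proof (rule card_mono[OF mu_full_bound(1)[OF assms refl]])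
  show "{\<A> :: nat set multiset. set_collection \<A> \<and> size \<A> = p \<and> double_covering \<A> \<and>
      standard \<A> \<and> (\<forall>A\<in>#\<A>. card A = l)} // E_rel \<subseteq>
    {\<A>. set_collection \<A> \<and> size \<A> = p \<and> double_covering \<A> \<and>
      (\<forall>A\<in>#\<A>. 1 \<le> card A \<and> card A \<le> l)} // E_rel"
    unfolding quotient_def by (rule UN_mono) (use assms in auto)
qed

subsection \<open>Connected graphs and isomorphisms\<close>

lemma double_covering_star_sets:
  assumes "\<And>k. k < length es \<Longrightarrow> fst (es ! k) < p \<and> snd (es ! k) < p \<and> fst (es ! k) \<noteq> snd (es ! k)"
  shows "double_covering (mset (star_sets p es))"
  unfolding double_covering_def
proof
  fix k assume "k \<in> \<Union>(set_mset (mset (star_sets p es)))"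
  then have k: "k < length es" by (auto simp: star_sets_def)
  have "size (filter_mset (\<lambda>A. k \<in> A) (mset (star_sets p es))) =
      card {v. v < p \<and> k \<in> star_sets p es ! v}"
    by (metis length_filter_conv_card mset_filter size_mset length_star_sets)
  also have "{v. v < p \<and> k \<in> star_sets p es ! v} = {fst (es ! k), snd (es ! k)}"
    using assms[OF k] k by auto
  also have "card \<dots> = 2"
    using assms[OF k] by simp
  finally show "size (filter_mset (\<lambda>A. k \<in> A) (mset (star_sets p es))) = 2" .
qed

lemma connected_star_sets:
  assumes "\<And>i. i < p \<Longrightarrow> \<exists>k<length es. es ! k = (i, Suc i mod p)"
  shows "connected_collection (mset (star_sets p es))"
  unfolding connected_collection_def
proof (intro ballI impI)
  fix A B assume "A \<in># mset (star_sets p es)" "B \<in># mset (star_sets p es)"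
  then obtain i j where i: "i < p" "A = star_sets p es ! i" and j: "j < p" "B = star_sets p es ! j"
    by (metis in_set_conv_nth length_star_sets set_mset_mset)
  \<comment> \<open>Walk round the cycle from \<open>i\<close>. Taking \<open>j + p - i\<close>
    steps reaches \<open>j\<close> modulo \<open>p\<close> without a truncated subtraction when
    \<open>j < i\<close>.\<close>
  define E where "E = (\<lambda>t. star_sets p es ! ((i + t) mod p))"
  have "p > 0" using i by simp
  have "E 0 = A" "E (j + p - i) = B"
    using i j by (simp_all add: E_def)
  moreover have "E t \<in># mset (star_sets p es)" for t
    using nth_mem[of "(i + t) mod p" "star_sets p es"] \<open>p > 0\<close> unfolding E_def by simp
  moreover have "E t \<inter> E (Suc t) \<noteq> {}" for t
  proof -
    obtain k where k: "k < length es" "es ! k = ((i + t) mod p, Suc ((i + t) mod p) mod p)"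
      using assms[of "(i + t) mod p"] \<open>p > 0\<close> by auto
    have "k \<in> E t \<inter> E (Suc t)"
      using k \<open>p > 0\<close> by (simp add: E_def mod_Suc_eq)
    then show ?thesis by blast
  qed
  ultimately show "\<exists>(m::nat) E. E 0 = A \<and> E m = B \<and> (\<forall>j\<le>m. E j \<in># mset (star_sets p es)) \<and>
      (\<forall>j<m. E j \<inter> E (Suc j) \<noteq> {})"
    by blast
qed

text \<open>Maximality forces every component to equal \<open>\<A>\<close>, so there are no two
  different components to compare.\<close>

lemma connected_imp_standard:
  assumes "connected_collection \<A>"
  shows "standard \<A>"
  using assms unfolding standard_def connected_component_of_def
  by (metis subset_mset.order_refl)

section \<open>Neighbourhoods, their transport by isomorphisms, and walks\<close>

definition nbrs :: "nat \<Rightarrow> (nat \<times> nat) list \<Rightarrow> nat \<Rightarrow> nat set" where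
  "nbrs p es v = {v'. v < p \<and> v' < p \<and> star_sets p es ! v \<inter> star_sets p es ! v' \<noteq> {}}"

lemma nbrs_subset: "nbrs p es v \<subseteq> {..<p}"
  by (auto simp: nbrs_def)

text \<open>Each edge at \<open>v\<close> contributes both of its ends, since \<open>v\<close>
  counts as its own neighbour when its star is nonempty; hence the factor 2.\<close>

lemma card_nbrs_le:
  assumes "\<And>v. v < p \<Longrightarrow> card (star_sets p es ! v) \<le> l"
  shows "card (nbrs p es v) \<le> 2 * l"
proof (cases "v < p")
  case True
  have fin: "finite (star_sets p es ! v)" using True by simp
  have "nbrs p es v \<subseteq> (\<lambda>k. fst (es ! k)) ` (star_sets p es ! v) \<union> (\<lambda>k. snd (es ! k)) ` (star_sets p es ! v)"
    by (auto simp: nbrs_def)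
  then have "card (nbrs p es v) \<le>
      card ((\<lambda>k. fst (es ! k)) ` (star_sets p es ! v) \<union> (\<lambda>k. snd (es ! k)) ` (star_sets p es ! v))"
    by (rule card_mono[rotated]) (use fin in blast)
  also have "\<dots> \<le> card (star_sets p es ! v) + card (star_sets p es ! v)"
    by (intro order_trans[OF card_Un_le] add_mono card_image_le fin)
  also have "\<dots> \<le> 2 * l"
    using assms[OF True] by simp
  finally show ?thesis .
qed (simp add: nbrs_def)

text \<open>An isomorphism acts on elements only. Matching the two equal multisets of stars position
  by position yields a permutation of the vertices, and the image of an edge lies in the stars of
  both image vertices.\<close>

lemma isomorphic_star_sets_permutes:
  assumes "isomorphic (mset (star_sets p es')) (mset (star_sets p es))"
    and lt: "\<And>k. k < length es' \<Longrightarrow> fst (es' ! k) < p \<and> snd (es' ! k) < p"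
  obtains \<pi> where "\<pi> permutes {..<p}"
    "\<And>k. k < length es' \<Longrightarrow> \<pi> (snd (es' ! k)) \<in> nbrs p es (\<pi> (fst (es' ! k)))"
proof -
  obtain \<phi> where "image_mset (image \<phi>) (mset (star_sets p es')) = mset (star_sets p es)"
    using assms(1) unfolding isomorphic_def by blast
  then have "mset (map (image \<phi>) (star_sets p es')) = mset (star_sets p es)" by simp
  then obtain \<pi> where \<pi>: "\<pi> permutes {..<length (star_sets p es)}"
    and eq: "permute_list \<pi> (star_sets p es) = map (image \<phi>) (star_sets p es')"
    by (rule mset_eq_permutation)
  have nth: "star_sets p es ! \<pi> v = \<phi> ` (star_sets p es' ! v)" if "v < p" for v
    using arg_cong[OF eq, of "\<lambda>xs. xs ! v"] that \<pi> by (simp add: permute_list_nth del: nth_star_sets)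
  have lt_\<pi>: "\<pi> v < p" if "v < p" for v
    using permutes_in_image[OF \<pi>, of v] that by simp
  show thesis
  proof (rule that[of \<pi>])
    show "\<pi> permutes {..<p}" using \<pi> by simp
    fix k assume k: "k < length es'"
    let ?u = "fst (es' ! k)" and ?w = "snd (es' ! k)"
    have "k \<in> star_sets p es' ! ?u" "k \<in> star_sets p es' ! ?w" using k lt[OF k] by auto
    then have "\<phi> k \<in> star_sets p es ! \<pi> ?u \<inter> star_sets p es ! \<pi> ?w"
      using lt[OF k] nth by (simp del: nth_star_sets)
    then show "\<pi> ?w \<in> nbrs p es (\<pi> ?u)"
      using lt[OF k] lt_\<pi> unfolding nbrs_def by blast
  qed
qed

lemma card_walks_le:
  assumes sub: "\<And>v. nb v \<subseteq> {..<p}" and card: "\<And>v. card (nb v) \<le> c"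
  shows "finite {xs :: nat list. length xs = Suc n \<and> xs ! 0 < p \<and> (\<forall>i<n. xs ! Suc i \<in> nb (xs ! i))}
    \<and> card {xs. length xs = Suc n \<and> xs ! 0 < p \<and> (\<forall>i<n. xs ! Suc i \<in> nb (xs ! i))} \<le> p * c ^ n"
proof (induction n)
  case 0
  have "{xs :: nat list. length xs = Suc 0 \<and> xs ! 0 < p} = (\<lambda>v. [v]) ` {..<p}"
    by (auto simp: length_Suc_conv)
  then show ?case using card_image_le[of "{..<p}" "\<lambda>v. [v]"] by simp
next
  case (Suc n)
  let ?W = "\<lambda>n. {xs :: nat list. length xs = Suc n \<and> xs ! 0 < p \<and> (\<forall>i<n. xs ! Suc i \<in> nb (xs ! i))}"
  have fin: "finite (SIGMA xs:?W n. nb (xs ! n))"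
    using Suc finite_subset[OF sub] by (intro finite_SigmaI) auto
  have "?W (Suc n) \<subseteq> (\<lambda>(xs, v). xs @ [v]) ` (SIGMA xs:?W n. nb (xs ! n))"
  proof
    fix ys assume ys: "ys \<in> ?W (Suc n)"
    then have "ys = take (Suc n) ys @ [ys ! Suc n]"
      by (metis (mono_tags, lifting) lessI mem_Collect_eq order_refl take_Suc_conv_app_nth take_all)
    moreover have "(take (Suc n) ys, ys ! Suc n) \<in> (SIGMA xs:?W n. nb (xs ! n))"
      using ys by simp
    ultimately show "ys \<in> (\<lambda>(xs, v). xs @ [v]) ` (SIGMA xs:?W n. nb (xs ! n))"
      by (metis (no_types, lifting) case_prod_conv image_eqI)
  qed
  then have "finite (?W (Suc n))" "card (?W (Suc n)) \<le> card (SIGMA xs:?W n. nb (xs ! n))"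
    using surj_card_le[OF fin] finite_surj[OF fin] by blast+
  moreover have "card (SIGMA xs:?W n. nb (xs ! n)) = (\<Sum>xs\<in>?W n. card (nb (xs ! n)))"
    using Suc finite_subset[OF sub] by (intro card_SigmaI) auto
  moreover have "\<dots> \<le> card (?W n) * c"
    using sum_bounded_above[of "?W n" "\<lambda>xs. card (nb (xs ! n))" c] card by simp
  moreover have "card (?W n) * c \<le> p * c ^ Suc n"
    using mult_le_mono1[OF conjunct2[OF Suc], of c] by (simp add: mult.assoc mult.commute)
  ultimately show ?case by linarith
qed

subsection \<open>Cycles with chords\<close>

text \<open>\<open>d\<close> stands for \<open>l - 2\<close>, the number of chord ends at each
  vertex, and \<open>N\<close> for the number of chords.\<close>

locale chorded_cycle =
  fixes p d N :: nat
  assumes p2: "p \<ge> 2" and N: "2 * N = p * d"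
begin

lemma d_le: "d \<le> N"
  using mult_le_mono1[OF p2, of d, folded N] by linarith

text \<open>Half-edge \<open>h < 2 * N\<close> sits at vertex \<open>h div d\<close>; the chords match the half-edges below \<open>N\<close>
  with those from \<open>N\<close> on. The offset \<open>d\<close> keeps the two ends of a chord apart: \<open>mate g q \<ge> q + d\<close>.\<close>

definition mate :: "(nat \<Rightarrow> nat) \<Rightarrow> nat \<Rightarrow> nat" where
  "mate g q = (if q < N - d then N + d + g q else q + d)"

definition chorded_edges :: "(nat \<Rightarrow> nat) \<Rightarrow> (nat \<times> nat) list" where
  "chorded_edges g = map (\<lambda>i. (i, Suc i mod p)) [0..<p] @ map (\<lambda>q. (q div d, mate g q div d)) [0..<N]"

abbreviation perms :: "(nat \<Rightarrow> nat) set" where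
  "perms \<equiv> {g. g permutes {..<N - d}}"

lemma perms_less: "g \<in> perms \<Longrightarrow> q < N - d \<Longrightarrow> g q < N - d"
  using permutes_in_image[of g "{..<N - d}" q] by simp

lemma mate_bounds:
  assumes "g \<in> perms" "q < N"
  shows "N \<le> mate g q" "mate g q < 2 * N" "q + d \<le> mate g q"
  using perms_less[OF assms(1), of q] assms(2) d_le by (auto simp: mate_def)

text \<open>The first \<open>N - d\<close> half-edges are permuted into
  \<open>{N + d..<2 * N}\<close> and the last \<open>d\<close> are shifted onto
  \<open>{N..<N + d}\<close>. So \<open>mate g\<close> is injective, and equal cardinalities give
  surjectivity.\<close>

lemma bij_mate:
  assumes "g \<in> perms"
  shows "bij_betw (mate g) {..<N} {N..<2 * N}"
proof -
  have "inj g" using assms permutes_inj by blast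
  have inj: "inj_on (mate g) {..<N}"
  proof (rule inj_onI)
    fix q r assume "q \<in> {..<N}" "r \<in> {..<N}" and eq: "mate g q = mate g r"
    then have "q < N" "r < N" by simp_all
    then show "q = r"
      using eq injD[OF \<open>inj g\<close>, of q r] unfolding mate_def
      by (cases "q < N - d"; cases "r < N - d") simp_all
  qed
  have "mate g ` {..<N} = {N..<2 * N}"
  proof (rule card_subset_eq)
    show "mate g ` {..<N} \<subseteq> {N..<2 * N}" using mate_bounds[OF assms] by auto
    show "card (mate g ` {..<N}) = card {N..<2 * N}" using card_image[OF inj] by simp
  qed simp
  with inj show ?thesis by (simp add: bij_betw_def)
qed

lemma length_chorded_edges [simp]: "length (chorded_edges g) = p + N"
  by (simp add: chorded_edges_def)

lemma nth_chorded_edges: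
  "k < p \<Longrightarrow> chorded_edges g ! k = (k, Suc k mod p)"
  "q < N \<Longrightarrow> chorded_edges g ! (p + q) = (q div d, mate g q div d)"
  by (simp_all add: chorded_edges_def nth_append)

lemma d_pos: "q < N \<Longrightarrow> d > 0"
  using N by (cases d) auto

lemma div_less: "h < 2 * N \<Longrightarrow> h div d < p"
  unfolding N by (rule less_mult_imp_div_less)

lemma chorded_edges_ends:
  assumes g: "g \<in> perms" and k: "k < length (chorded_edges g)"
  shows "fst (chorded_edges g ! k) < p \<and> snd (chorded_edges g ! k) < p \<and>
    fst (chorded_edges g ! k) \<noteq> snd (chorded_edges g ! k)"
proof (cases "k < p")
  case True
  then show ?thesis using p2 by (auto simp: nth_chorded_edges mod_Suc)
next
  case False
  define q where "q = k - p"
  have q: "k = p + q" "q < N" using False k by (auto simp: q_def)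
  have "Suc (q div d) \<le> mate g q div d"
    using div_le_mono[OF mate_bounds(3)[OF g q(2)], of d] d_pos[OF q(2)] by simp
  then show ?thesis
    using q nth_chorded_edges(2) div_less[of q] div_less[of "mate g q"] mate_bounds[OF g q(2)] by simp
qed

lemma card_div_eq:
  assumes "v < p" "d > 0"
  shows "card {h. h < 2 * N \<and> h div d = v} = d"
proof -
  have key: "h div d = v \<longleftrightarrow> v * d \<le> h \<and> h < v * d + d" for h
  proof
    show "h div d = v \<Longrightarrow> v * d \<le> h \<and> h < v * d + d"
      using div_times_less_eq_dividend[of h d] dividend_less_div_times[OF assms(2), of h] by simp
    show "v * d \<le> h \<and> h < v * d + d \<Longrightarrow> h div d = v"
      by (rule div_nat_eqI) (simp_all add: mult.commute)
  qed
  have le: "v * d + d \<le> 2 * N"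
    using mult_le_mono1[of "Suc v" p d] assms(1) unfolding N by simp
  have "{h. h < 2 * N \<and> h div d = v} = {v * d..<v * d + d}"
    unfolding key using le by (intro set_eqI) (simp, linarith)
  then show ?thesis by simp
qed

text \<open>Two cycle edges meet \<open>v\<close>, at positions \<open>v\<close> and
  \<open>pr\<close>. The chords with lower end at \<open>v\<close> form \<open>Q\<close>, those with
  upper end at \<open>v\<close> form \<open>R\<close>; \<open>Q\<close> and the mates of
  \<open>R\<close> together are exactly the \<open>d\<close> half-edges at \<open>v\<close>.\<close>

lemma card_star_sets_chorded:
  assumes g: "g \<in> perms" and v: "v < p"
  shows "card (star_sets p (chorded_edges g) ! v) = d + 2"
proof -
  define Q where "Q = {q. q < N \<and> q div d = v}"
  define R where "R = {q. q < N \<and> mate g q div d = v}"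
  define pr where "pr = (if v = 0 then p - 1 else v - 1)"
  have Suc_eq: "v = Suc k mod p \<longleftrightarrow> k = pr" if "k < p" for k
    using that v by (auto simp: pr_def mod_Suc)
  have pr: "pr < p" "pr \<noteq> v" using v p2 by (auto simp: pr_def)
  have "star_sets p (chorded_edges g) ! v = {v, pr} \<union> (\<lambda>q. p + q) ` (Q \<union> R)" (is "?L = ?R")
  proof (rule set_eqI)
    fix k
    consider "k < p" | q where "k = p + q" "q < N" | "k \<ge> p + N"
    proof -
      have "k < p \<or> (\<exists>q. k = p + q \<and> q < N) \<or> k \<ge> p + N" by presburger
      then show thesis using that by blast
    qed
    then show "k \<in> ?L \<longleftrightarrow> k \<in> ?R"
    proof cases
      case 1
      then show ?thesis using v Suc_eq[of k] by (auto simp: nth_chorded_edges)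
    next
      case 2
      then show ?thesis using v pr by (auto simp: nth_chorded_edges Q_def R_def)
    next
      case 3
      then show ?thesis using v pr by (auto simp: Q_def R_def)
    qed
  qed
  moreover have "{v, pr} \<inter> (\<lambda>q. p + q) ` (Q \<union> R) = {}" using v pr by auto
  moreover have "card {v, pr} = 2" using pr by simp
  moreover have "card ((\<lambda>q. p + q) ` (Q \<union> R)) = card (Q \<union> R)" by (rule card_image) simp
  moreover have "finite (Q \<union> R)" by (simp add: Q_def R_def)
  ultimately have "card (star_sets p (chorded_edges g) ! v) = 2 + card (Q \<union> R)"
    using card_Un_disjoint[of "{v, pr}" "(\<lambda>q. p + q) ` (Q \<union> R)"] by (simp only: finite.intros finite_imageI)
  moreover have "card (Q \<union> R) = d"
  proof (cases "d = 0")
    case True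
    then show ?thesis using N by (simp add: Q_def R_def)
  next
    case False
    have "Q \<inter> R = {}"
    proof -
      have "mate g q div d \<noteq> q div d" if "q < N" for q
        using chorded_edges_ends[OF g, of "p + q"] nth_chorded_edges(2)[OF that] that by simp
      then show ?thesis by (auto simp: Q_def R_def)
    qed
    then have "card (Q \<union> R) = card Q + card R"
      by (intro card_Un_disjoint) (simp_all add: Q_def R_def)
    also have "card R = card (mate g ` R)"
      using bij_mate[OF g] by (intro card_image[symmetric]) (auto simp: bij_betw_def R_def inj_on_def)
    also have "mate g ` R = {h \<in> mate g ` {..<N}. h div d = v}"
      by (auto simp: R_def)
    also have "\<dots> = {h \<in> {N..<2 * N}. h div d = v}"
      using bij_mate[OF g] by (simp add: bij_betw_def)
    also have "card Q + card \<dots> = card (Q \<union> {h \<in> {N..<2 * N}. h div d = v})"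
      by (intro card_Un_disjoint[symmetric]) (auto simp: Q_def)
    also have "Q \<union> {h \<in> {N..<2 * N}. h div d = v} = {h. h < 2 * N \<and> h div d = v}"
      by (auto simp: Q_def)
    finally show ?thesis using card_div_eq[OF v] False by simp
  qed
  ultimately show ?thesis by simp
qed

section \<open>Isomorphism classes of chorded cycles\<close>

definition graph_of :: "(nat \<Rightarrow> nat) \<Rightarrow> nat set multiset" where
  "graph_of g = mset (star_sets p (chorded_edges g))"

lemma graph_of_standard:
  assumes g: "g \<in> perms"
  shows "graph_of g \<in> {\<A>. set_collection \<A> \<and> size \<A> = p \<and> double_covering \<A> \<and>
    standard \<A> \<and> (\<forall>A \<in># \<A>. card A = d + 2)}"
proof -
  have "connected_collection (graph_of g)"
    unfolding graph_of_def
  proof (rule connected_star_sets)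
    fix i assume "i < p"
    then show "\<exists>k<length (chorded_edges g). chorded_edges g ! k = (i, Suc i mod p)"
      by (intro exI[of _ i]) (simp add: nth_chorded_edges)
  qed
  moreover have "card A = d + 2" if "A \<in># graph_of g" for A
    using that card_star_sets_chorded[OF g] unfolding graph_of_def
    by (metis in_set_conv_nth length_star_sets set_mset_mset)
  ultimately show ?thesis
    using chorded_edges_ends[OF g] connected_imp_standard
    by (auto simp: graph_of_def set_collection_star_sets intro!: double_covering_star_sets)
qed

text \<open>Let \<open>xs\<close> list the images of the vertices under an isomorphism. The cycle
  edges make \<open>xs\<close> a walk in \<open>graph_of g0\<close>, so \<open>xs\<close> lies in
  \<open>W\<close>. Given \<open>xs\<close>, each chord with \<open>q < N - d\<close> must end at
  one of at most \<open>2 * (d + 2)\<close> neighbours, at one of its \<open>d\<close>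
  half-edges.\<close>

lemma card_perms_isomorphic_le:
  assumes g0: "g0 \<in> perms"
  shows "card {g \<in> perms. isomorphic (graph_of g) (graph_of g0)} \<le>
    p * (2 * (d + 2)) ^ (p - 1) * (2 * (d + 2) * d) ^ (N - d)"
proof -
  define nb where "nb = nbrs p (chorded_edges g0)"
  have card_nb: "card (nb v) \<le> 2 * (d + 2)" for v
    unfolding nb_def by (rule card_nbrs_le) (simp only: card_star_sets_chorded[OF g0] order_refl)
  have nb_sub: "nb v \<subseteq> {..<p}" for v unfolding nb_def by (rule nbrs_subset)
  define W where "W = {xs :: nat list. length xs = Suc (p - 1) \<and> xs ! 0 < p \<and>
    (\<forall>i<p - 1. xs ! Suc i \<in> nb (xs ! i))}"
  define T where "T = (\<lambda>xs. {g \<in> perms. distinct xs \<and>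
    (\<forall>q<N - d. xs ! (mate g q div d) \<in> nb (xs ! (q div d)))})"
  have finW: "finite W" and card_W: "card W \<le> p * (2 * (d + 2)) ^ (p - 1)"
    using card_walks_le[of nb p "2 * (d + 2)" "p - 1"] nb_sub card_nb unfolding W_def by blast+
  have finT: "finite (T xs)" for xs
    by (rule finite_subset[OF _ finite_permutations[of "{..<N - d}"]]) (auto simp: T_def)
  have card_T: "card (T xs) \<le> (2 * (d + 2) * d) ^ (N - d)" if xs: "length xs = p" for xs
  proof (cases "distinct xs")
    case True
    \<comment> \<open>The candidates for \<open>g q\<close>. As \<open>xs\<close> is distinct, a
      neighbour \<open>v\<close> determines the vertex \<open>(N + d + x) div d\<close>, which
      leaves at most \<open>d\<close> values of \<open>x\<close>.\<close>
    define Q where "Q = (\<lambda>q. {x. x < N - d \<and> xs ! ((N + d + x) div d) \<in> nb (xs ! (q div d))})"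
    have card_Q: "card (Q q) \<le> 2 * (d + 2) * d" for q
    proof -
      let ?f = "\<lambda>v. {x. x < N - d \<and> xs ! ((N + d + x) div d) = v}"
      have f: "card (?f v) \<le> d" for v
      proof (cases "?f v = {}")
        case False
        then obtain y where y: "y < N - d" "xs ! ((N + d + y) div d) = v" by blast
        then have d: "d > 0" using d_pos[of y] by simp
        let ?j = "(N + d + y) div d"
        have j: "?j < p" by (rule div_less) (use y(1) in \<open>simp add: less_diff_conv\<close>)
        have "(N + d + x) div d = ?j" if "x \<in> ?f v" for x
        proof -
          have "(N + d + x) div d < p" by (rule div_less) (use that in \<open>simp add: less_diff_conv\<close>)
          then show ?thesis
            using j y that nth_eq_iff_index_eq[OF True, of "(N + d + x) div d" ?j] xs by simp
        qed
        then have "(\<lambda>x. N + d + x) ` ?f v \<subseteq> {h. h < 2 * N \<and> h div d = ?j}"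
          using d_le by auto
        then have "card (?f v) \<le> card {h. h < 2 * N \<and> h div d = ?j}"
          by (intro card_inj_on_le[of "\<lambda>x. N + d + x"]) auto
        then show ?thesis using card_div_eq[OF j d] by simp
      next
        case True
        then show ?thesis by (simp only: card.empty)
      qed
      have finnb: "finite (nb v)" for v using nb_sub finite_subset by blast
      have "Q q = (\<Union>v\<in>nb (xs ! (q div d)). ?f v)" by (auto simp: Q_def)
      then have "card (Q q) \<le> (\<Sum>v\<in>nb (xs ! (q div d)). card (?f v))"
        using card_UN_le[OF finnb] by simp
      also have "\<dots> \<le> card (nb (xs ! (q div d))) * d"
        using sum_bounded_above[of "nb (xs ! (q div d))" "\<lambda>v. card (?f v)" d] f by simp
      also have "\<dots> \<le> 2 * (d + 2) * d"
        using card_nb by (rule mult_le_mono1)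
      finally show ?thesis .
    qed
    \<comment> \<open>Permutations fix everything outside \<open>{..<N - d}\<close>, so restricting
      them loses nothing and places them in a finite product.\<close>
    have "inj_on (\<lambda>g. restrict g {..<N - d}) (T xs)"
    proof (rule inj_onI)
      fix g h assume gh: "g \<in> T xs" "h \<in> T xs" "restrict g {..<N - d} = restrict h {..<N - d}"
      show "g = h"
      proof
        fix x
        show "g x = h x"
        proof (cases "x \<in> {..<N - d}")
          case True
          then show ?thesis using gh(3) by (metis restrict_apply')
        next
          case False
          have "g permutes {..<N - d}" "h permutes {..<N - d}" using gh(1,2) by (auto simp: T_def)
          with False show ?thesis by (metis permutes_not_in)
        qed
      qed
    qed
    moreover have "(\<lambda>g. restrict g {..<N - d}) ` T xs \<subseteq> PiE {..<N - d} Q"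
      using perms_less
      by (intro image_subsetI) (simp add: restrict_PiE_iff T_def Q_def mate_def)
    moreover have "finite (PiE {..<N - d} Q)"
      by (intro finite_PiE) (auto simp: Q_def)
    ultimately have "card (T xs) \<le> card (PiE {..<N - d} Q)"
      by (rule card_inj_on_le)
    also have "\<dots> = (\<Prod>q<N - d. card (Q q))" by (simp add: card_PiE)
    also have "\<dots> \<le> (\<Prod>q<N - d. 2 * (d + 2) * d)"
      by (rule prod_mono) (use card_Q in simp)
    finally show ?thesis by simp
  qed (simp add: T_def)
  have "{g \<in> perms. isomorphic (graph_of g) (graph_of g0)} \<subseteq> (\<Union>xs\<in>W. T xs)"
  proof
    fix g assume "g \<in> {g \<in> perms. isomorphic (graph_of g) (graph_of g0)}"
    then have g: "g \<in> perms" and iso: "isomorphic (graph_of g) (graph_of g0)" by auto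
    obtain \<pi> where \<pi>: "\<pi> permutes {..<p}"
      and nb: "\<And>k. k < length (chorded_edges g) \<Longrightarrow>
        \<pi> (snd (chorded_edges g ! k)) \<in> nb (\<pi> (fst (chorded_edges g ! k)))"
      unfolding nb_def
      using isomorphic_star_sets_permutes[OF iso[unfolded graph_of_def]] chorded_edges_ends[OF g] by blast
    define xs where "xs = map \<pi> [0..<p]"
    have "xs \<in> W"
      unfolding W_def
    proof (intro CollectI conjI allI impI)
      show "length xs = Suc (p - 1)" using p2 by (simp add: xs_def)
      show "xs ! 0 < p" using permutes_in_image[OF \<pi>, of 0] p2 by (simp add: xs_def)
      fix i assume "i < p - 1"
      then show "xs ! Suc i \<in> nb (xs ! i)"
        using nb[of i] by (simp add: xs_def nth_chorded_edges)
    qed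
    moreover have "g \<in> T xs"
    proof -
      have "distinct xs"
        using permutes_inj_on[OF \<pi>] by (simp add: xs_def distinct_map)
      moreover have "xs ! (mate g q div d) \<in> nb (xs ! (q div d))" if "q < N - d" for q
        using nb[of "p + q"] that nth_chorded_edges(2)[of q g] div_less[of q] div_less[of "mate g q"]
          mate_bounds[OF g, of q] by (simp add: xs_def)
      ultimately show ?thesis using g by (simp add: T_def)
    qed
    ultimately show "g \<in> (\<Union>xs\<in>W. T xs)" by blast
  qed
  then have "card {g \<in> perms. isomorphic (graph_of g) (graph_of g0)} \<le> card (\<Union>xs\<in>W. T xs)"
    by (rule card_mono[rotated]) (use finW finT in blast)
  also have "\<dots> \<le> (\<Sum>xs\<in>W. card (T xs))" by (rule card_UN_le[OF finW])
  also have "\<dots> \<le> card W * (2 * (d + 2) * d) ^ (N - d)"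
    using sum_bounded_above[of W "\<lambda>xs. card (T xs)" "(2 * (d + 2) * d) ^ (N - d)"] card_T p2
    by (simp add: W_def)
  also have "\<dots> \<le> p * (2 * (d + 2)) ^ (p - 1) * (2 * (d + 2) * d) ^ (N - d)"
    using card_W by (rule mult_le_mono1)
  finally show ?thesis .
qed

text \<open>The \<open>fact (N - d)\<close> permutations are split by the class of their graph, and
  each fibre has at most \<open>?K\<close> members.\<close>

lemma fact_le_mu_standard:
  "fact (N - d) \<le> mu_standard (d + 2) p * (p * (2 * (d + 2)) ^ (p - 1) * (2 * (d + 2) * d) ^ (N - d))"
proof -
  let ?S = "{\<A> :: nat set multiset. set_collection \<A> \<and> size \<A> = p \<and> double_covering \<A> \<and>
    standard \<A> \<and> (\<forall>A \<in># \<A>. card A = d + 2)}"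
  let ?K = "p * (2 * (d + 2)) ^ (p - 1) * (2 * (d + 2) * d) ^ (N - d)"
  define h where "h = (\<lambda>g. E_rel `` {graph_of g})"
  have finP: "finite perms" by (rule finite_permutations) simp
  have sub: "h ` perms \<subseteq> ?S // E_rel"
    using graph_of_standard unfolding h_def by (auto intro: quotientI)
  \<comment> \<open>Finiteness is inherited from the coding of all double coverings.\<close>
  have fin: "finite (?S // E_rel)"
  proof (rule finite_subset)
    show "?S // E_rel \<subseteq> {\<A>. set_collection \<A> \<and> size \<A> = p \<and> double_covering \<A> \<and>
        (\<forall>A \<in># \<A>. 1 \<le> card A \<and> card A \<le> d + 2)} // E_rel"
      unfolding quotient_def by (rule UN_mono) auto
    show "finite ({\<A> :: nat set multiset. set_collection \<A> \<and> size \<A> = p \<and> double_covering \<A> \<and>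
        (\<forall>A \<in># \<A>. 1 \<le> card A \<and> card A \<le> d + 2)} // E_rel)"
      by (rule mu_full_bound(1)[OF _ _ refl]) (use p2 in simp_all)
  qed
  have fiber: "card {g \<in> perms. h g = c} \<le> ?K" if "c \<in> h ` perms" for c
  proof -
    obtain g0 where g0: "g0 \<in> perms" "c = h g0" using \<open>c \<in> h ` perms\<close> by blast
    have "isomorphic (graph_of g) (graph_of g0)" if "g \<in> perms" "h g = h g0" for g
    proof -
      have "(graph_of g, graph_of g0) \<in> E_rel"
        using that graph_of_standard g0 unfolding h_def
        by (intro eq_equiv_class[OF _ equiv_E_rel]) auto
      then show ?thesis by (simp add: E_rel_def)
    qed
    then have "{g \<in> perms. h g = c} \<subseteq> {g \<in> perms. isomorphic (graph_of g) (graph_of g0)}"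
      using g0 by auto
    then have "card {g \<in> perms. h g = c} \<le> card {g \<in> perms. isomorphic (graph_of g) (graph_of g0)}"
      by (rule card_mono[rotated]) (rule finite_subset[OF _ finP], blast)
    then show ?thesis using card_perms_isomorphic_le[OF g0(1)] by linarith
  qed
  have "fact (N - d) = card perms" by (rule card_permutations[symmetric]) simp_all
  also have "perms = (\<Union>c\<in>h ` perms. {g \<in> perms. h g = c})" by blast
  also have "card \<dots> \<le> (\<Sum>c\<in>h ` perms. card {g \<in> perms. h g = c})"
    by (rule card_UN_le) (use finP in blast)
  also have "\<dots> \<le> card (h ` perms) * ?K"
    using sum_bounded_above[of "h ` perms" "\<lambda>c. card {g \<in> perms. h g = c}" ?K] fiber by simp
  also have "\<dots> \<le> mu_standard (d + 2) p * ?K"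
    unfolding mu_standard_def by (rule mult_le_mono1) (rule card_mono[OF fin sub])
  finally show ?thesis .
qed

end

subsection \<open>The lower bound\<close>

text \<open>\<open>n ^ n / fact n\<close> is one term of the exponential series at \<open>n\<close>,
  and \<open>exp 1 \<le> 3\<close>.\<close>

lemma power_self_le_fact: "n ^ n \<le> 3 ^ n * fact n"
proof -
  have "real n ^ n /\<^sub>R fact n \<le> exp (real n)"
  proof -
    have "(\<Sum>k\<in>{n}. real n ^ k /\<^sub>R fact k) \<le> (\<Sum>k. real n ^ k /\<^sub>R fact k)"
      by (rule sum_le_suminf) (simp_all add: summable_exp)
    then show ?thesis by (simp add: exp_def)
  qed
  also have "exp (real n) = exp 1 ^ n"
    by (metis exp_of_nat_mult mult.right_neutral)
  also have "\<dots> \<le> 3 ^ n"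
    by (intro power_mono exp_le) simp
  finally have "real n ^ n \<le> 3 ^ n * fact n"
    by (simp add: field_simps)
  then have "real (n ^ n) \<le> real (3 ^ n * fact n)" by simp
  then show ?thesis by (simp only: of_nat_le_iff)
qed

text \<open>Passing from \<open>p ^ N\<close> to \<open>fact (N - d)\<close>, and from there to the
  number of classes, costs factors that are all at most \<open>p\<close>-th powers of constants
  depending on \<open>d\<close>.\<close>

lemma power_le_mu_standard:
  assumes "p \<ge> 2" "2 * N = p * d"
  shows "p ^ N \<le> mu_standard (d + 2) p *
    (6 ^ d * (2 * (d + 1)) ^ d * (2 * (2 * (d + 2))) * (2 * (d + 2) * (d + 2)) ^ d) ^ p"
proof -
  interpret chorded_cycle p d N by unfold_locales (use assms in auto)
  let ?mu = "mu_standard (d + 2) p"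
  have N_le: "N \<le> d * p" using assms(2) by (simp add: mult.commute)
  have p_le: "p \<le> 2 ^ p" by (simp add: less_imp_le)
  have regroup: "x ^ (d * p) * (m * (2 ^ p * y ^ p * z ^ (d * p)) * (w ^ p) ^ d) =
      m * (x ^ d * w ^ d * (2 * y) * z ^ d) ^ p" for x y z w m :: nat
    by (simp add: power_mult_distrib power_mult[symmetric] mult_ac)
  \<comment> \<open>For \<open>d > 0\<close>, \<open>p \<le> p * d = 2 * N\<close>; for
    \<open>d = 0\<close>, \<open>N = 0\<close> and both powers are 1.\<close>
  have "p ^ N \<le> (2 * N) ^ N"
  proof (cases "d = 0")
    case False
    then show ?thesis unfolding assms(2) by (intro power_mono) simp_all
  qed (use assms(2) in simp)
  also have "\<dots> = 2 ^ N * N ^ N" by (rule power_mult_distrib)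
  also have "\<dots> \<le> 2 ^ N * (3 ^ N * fact N)"
    by (intro mult_le_mono2 power_self_le_fact)
  also have "\<dots> = 6 ^ N * fact N"
    by (simp add: power_mult_distrib[symmetric] mult.assoc[symmetric])
  also have "fact N = fact (N - d) * (fact N div fact (N - d) :: nat)"
    by (simp add: fact_dvd)
  also have "\<dots> \<le> fact (N - d) * N ^ d"
    by (intro mult_le_mono2 fact_div_fact_le_pow d_le)
  also have "\<dots> \<le> ?mu * (p * (2 * (d + 2)) ^ (p - 1) * (2 * (d + 2) * d) ^ (N - d)) * N ^ d"
    by (intro mult_le_mono1 fact_le_mu_standard)
  also have "\<dots> \<le> ?mu * (2 ^ p * (2 * (d + 2)) ^ p * (2 * (d + 2) * (d + 2)) ^ (d * p)) * ((2 * (d + 1)) ^ p) ^ d"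
  proof (intro mult_le_mono order_refl p_le)
    show "(2 * (d + 2)) ^ (p - 1) \<le> (2 * (d + 2)) ^ p"
      by (rule power_increasing) simp_all
    \<comment> \<open>Replacing the factor \<open>d\<close> by \<open>d + 2\<close> makes the base
      positive even for \<open>d = 0\<close>, so the exponent may be enlarged.\<close>
    have "(2 * (d + 2) * d) ^ (N - d) \<le> (2 * (d + 2) * (d + 2)) ^ (N - d)"
      by (intro power_mono mult_le_mono) simp_all
    also have "\<dots> \<le> (2 * (d + 2) * (d + 2)) ^ (d * p)"
      by (rule power_increasing) (use N_le in simp_all)
    finally show "(2 * (d + 2) * d) ^ (N - d) \<le> (2 * (d + 2) * (d + 2)) ^ (d * p)" .
    \<comment> \<open>Bounding \<open>d\<close> and \<open>p\<close> separately puts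
      \<open>N\<close> below a \<open>p\<close>-th power, which absorbs the factor
      \<open>N ^ d\<close>.\<close>
    have "d \<le> (d + 1) ^ p"
      using self_le_power[of "d + 1" p] assms(1) by simp
    then have "d * p \<le> (d + 1) ^ p * 2 ^ p"
      using p_le by (rule mult_le_mono)
    then have "N \<le> (2 * (d + 1)) ^ p"
      using N_le by (simp only: power_mult_distrib mult.commute)
    then show "N ^ d \<le> ((2 * (d + 1)) ^ p) ^ d"
      by (rule power_mono) simp
  qed
  also have "6 ^ N \<le> (6 ^ (d * p) :: nat)"
    by (rule power_increasing) (use N_le in simp_all)
  finally have "p ^ N \<le> 6 ^ (d * p) * (?mu * (2 ^ p * (2 * (d + 2)) ^ p *
      (2 * (d + 2) * (d + 2)) ^ (d * p)) * ((2 * (d + 1)) ^ p) ^ d)"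
    by simp
  also have "\<dots> = ?mu * (6 ^ d * (2 * (d + 1)) ^ d * (2 * (2 * (d + 2))) * (2 * (d + 2) * (d + 2)) ^ d) ^ p"
    by (rule regroup)
  finally show ?thesis .
qed

theorem theorem1p2:
  fixes l :: nat
  assumes "l \<ge> 2"
  shows "\<exists>a b :: real. a > 0 \<and> b > 0 \<and>
    (\<forall>p::nat. p \<ge> 2 \<and> even (p * l) \<longrightarrow>
       a ^ p * real p powr (real p * (real l / 2 - 1)) \<le> real (mu_standard l p) \<and>
       mu_standard l p \<le> mu_full l p \<and>
       real (mu_full l p) \<le> b ^ p * real p powr (real p * (real l / 2 - 1)))"
proof -
  define d where "d = l - 2"
  have l: "l = d + 2" using assms by (simp add: d_def)
  define B where "B = 6 ^ d * (2 * (d + 1)) ^ d * (2 * (2 * (d + 2))) * (2 * (d + 2) * (d + 2)) ^ d"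
  have "B > 0" by (simp add: B_def)
  show ?thesis
  \<comment> \<open>\<open>B\<close> is the constant lost in the lower bound; the exponent
    \<open>7 + l\<close> comes from \<open>7 * p + N \<le> (7 + l) * p\<close>.\<close>
  proof (rule exI[of _ "1 / real B"], rule exI[of _ "2 ^ (7 + l)"], intro conjI allI impI)
    fix p assume p: "p \<ge> 2 \<and> even (p * l)"
    define N where "N = p * d div 2"
    have "even (p * d)" using p by (auto simp: l)
    then have N2: "2 * N = p * d" by (simp add: N_def)
    then have "2 * real N = real p * real d" by (metis of_nat_mult of_nat_numeral)
    \<comment> \<open>Evenness of \<open>p * l\<close> makes the real exponent the natural number
      \<open>N\<close>, so \<open>powr\<close> becomes an ordinary power.\<close>
    then have "real p * (real l / 2 - 1) = real N" by (simp add: l field_simps)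
    then have powr: "real p powr (real p * (real l / 2 - 1)) = real p ^ N"
      using p by (simp add: powr_realpow)
    have "real (p ^ N) \<le> real (mu_standard l p * B ^ p)"
      using power_le_mu_standard[of p N d] p N2 unfolding B_def l of_nat_le_iff by simp
    then show "(1 / real B) ^ p * real p powr (real p * (real l / 2 - 1)) \<le> real (mu_standard l p)"
      unfolding powr using \<open>B > 0\<close> by (simp add: field_simps power_divide)
    show "mu_standard l p \<le> mu_full l p"
      using p assms by (intro mu_standard_le_mu_full) auto
    have "mu_full l p \<le> 2 ^ (7 * p + N) * p ^ N"
      using p assms by (intro mu_full_bound(2)) (auto simp: N_def d_def)
    also have "\<dots> \<le> 2 ^ ((7 + l) * p) * p ^ N"
    proof (intro mult_le_mono1 power_increasing)
      have "N \<le> l * p" using N2 by (simp add: l algebra_simps)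
      then show "7 * p + N \<le> (7 + l) * p" by (simp add: algebra_simps)
    qed simp
    also have "\<dots> = (2 ^ (7 + l)) ^ p * p ^ N" by (simp only: power_mult)
    finally have "real (mu_full l p) \<le> real ((2 ^ (7 + l)) ^ p * p ^ N)"
      by (rule of_nat_mono)
    then show "real (mu_full l p) \<le> (2 ^ (7 + l)) ^ p * real p powr (real p * (real l / 2 - 1))"
      unfolding powr by simp
  qed (use \<open>B > 0\<close> in simp_all)
qed

end
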